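(* For all positive integers $n \ge d \ge 2$ there exists a collection $\mathcal{A} \subset \mathcal{P}([n]^d)$ with $|\mathcal{A}| = |\mathcal{P}([n]^d)|/2$ such that there is no pair $(A,B) \in \mathcal{A} \times \mathcal{A}$ satisfying $A \,\Delta\, B = S^d$ for some non-empty subset $S \subset [n]$ that can be written as a union of at most $\lfloor d/2 \rfloor$ intervals.
   Context: $[n]=\{1,\dots,n\}$; for integers $a \le b$, $[a,b]=\{a,a+1,\dots,b\}$ is called an interval. $\mathcal{P}(X)$ denotes the power set of $X$, $A\,\Delta\, B$ the symmetric difference, and $S^d = S\times\dots\times S \subset [n]^d$ ($d$ factors). *)

theory Defs
  imports Complex_Main "HOL-Library.FuncSet"
begin

text \<open>The d-fold Cartesian power of S: d-tuples are extensional functions on the index set {1..d}.\<close>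

definition cart_power :: "nat set \<Rightarrow> nat \<Rightarrow> (nat \<Rightarrow> nat) set" where
  "cart_power S d = ({1..d} \<rightarrow>\<^sub>E S)"

definition int_interval :: "nat set \<Rightarrow> bool" where
  "int_interval I \<longleftrightarrow> (\<exists>a b. a \<le> b \<and> I = {a..b})"

definition union_of_at_most_intervals :: "nat \<Rightarrow> nat set \<Rightarrow> bool" where
  "union_of_at_most_intervals k S \<longleftrightarrow>
     (\<exists>\<I>. finite \<I> \<and> card \<I> \<le> k \<and> (\<forall>I\<in>\<I>. int_interval I) \<and> S = \<Union>\<I>)"

end

theory Submission
  imports Defs
begin

text \<open>It suffices to find \<open>W\<close> meeting \<open>S\<^sup>d\<close> in an odd number of points for every admissible \<open>S\<close>:
  then the sets \<open>A\<close> with \<open>\<bar>A \<inter> W\<bar>\<close> even form the required family. Grouping tuples by their image,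
  the functions \<open>S \<mapsto> \<bar>W \<inter> S\<^sup>d\<bar> mod 2\<close> are exactly the polynomials of degree at most \<open>d\<close> over the
  two-element field, without constant term, in the indicator variables \<open>x\<^sub>i\<close> of \<open>S\<close>.
  The maximal intervals of \<open>S\<close> correspond to their left endpoints, detected by the quadratic
  polynomials \<open>y\<^sub>i = x\<^sub>i (1 - x\<^sub>i\<^sub>-\<^sub>1)\<close>. The sum of the elementary symmetric polynomials
  \<open>e\<^sub>1, \<dots>, e\<^sub>k\<close> in the \<open>y\<^sub>i\<close>, where \<open>k = \<lfloor>d/2\<rfloor>\<close>, has degree at most \<open>2k \<le> d\<close>, and it counts the
  non-empty sets of at most \<open>k\<close> left endpoints. If \<open>S\<close> has \<open>m\<close> left endpoints with
  \<open>1 \<le> m \<le> k\<close>, this number is \<open>2\<^sup>m - 1\<close>, which is odd.\<close>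

lemma even_card_sym_diff:
  assumes "finite A" "finite B"
  shows "even (card (sym_diff A B)) \<longleftrightarrow> (even (card A) \<longleftrightarrow> even (card B))"
proof -
  have "card A = card (A \<inter> B) + card (A - B)" "card B = card (A \<inter> B) + card (B - A)"
    using assms card_Int_Diff[of A B] card_Int_Diff[of B A] by (simp_all add: Int_commute)
  moreover have "card (sym_diff A B) = card (A - B) + card (B - A)"
    using assms by (intro card_Un_disjoint) auto
  ultimately show ?thesis by auto
qed

lemma odd_card_Pow_iff: "finite A \<Longrightarrow> odd (card (Pow A)) \<longleftrightarrow> A = {}"
  by (simp add: card_Pow)

lemma odd_card_nonempty_subsets:
  assumes "finite A" "A \<noteq> {}"
  shows "odd (card (Pow A - {{}}))"
  using assms by (simp add: card_Pow)

lemma card_Pow_even_Int: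
  assumes "finite U" "U \<inter> W \<noteq> {}"
  shows "2 * card {A \<in> Pow U. even (card (A \<inter> W))} = card (Pow U)"
proof -
  obtain w where w: "w \<in> U" "w \<in> W" using assms(2) by blast
  let ?even = "{A \<in> Pow U. even (card (A \<inter> W))}" and ?odd = "{A \<in> Pow U. odd (card (A \<inter> W))}"
  let ?toggle = "\<lambda>A. sym_diff A {w}"
  have toggle_parity: "even (card (?toggle A \<inter> W)) \<longleftrightarrow> odd (card (A \<inter> W))" if "A \<subseteq> U" for A
  proof -
    have "?toggle A \<inter> W = sym_diff (A \<inter> W) {w}" using w(2) by blast
    moreover have "finite (A \<inter> W)" using that assms(1) finite_subset by blast
    ultimately show ?thesis by (simp add: even_card_sym_diff)
  qed
  have "bij_betw ?toggle ?even ?odd"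
    by (rule bij_betw_byWitness[where f' = ?toggle]) (use w(1) toggle_parity in auto)
  then have "card ?even = card ?odd" by (rule bij_betw_same_card)
  moreover have "card (Pow U) = card (?even \<union> ?odd)" by (rule arg_cong[where f = card]) blast
  moreover have "card (?even \<union> ?odd) = card ?even + card ?odd"
    using assms(1) by (intro card_Un_disjoint) auto
  ultimately show ?thesis by simp
qed

lemma exists_half_family_avoiding_sym_diffs:
  assumes "finite U" "\<D> \<subseteq> Pow U" "\<D> \<noteq> {}"
    and odd_Int: "\<And>D. D \<in> \<D> \<Longrightarrow> odd (card (W \<inter> D))"
  shows "\<exists>\<A>\<subseteq>Pow U. 2 * card \<A> = card (Pow U) \<and> (\<forall>A\<in>\<A>. \<forall>B\<in>\<A>. sym_diff A B \<notin> \<D>)"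
proof (intro exI conjI ballI notI)
  let ?\<A> = "{A \<in> Pow U. even (card (A \<inter> W))}"
  show "?\<A> \<subseteq> Pow U" by blast
  obtain D where "D \<in> \<D>" using assms(3) by blast
  then have "W \<inter> D \<noteq> {}" "D \<subseteq> U" using odd_card_imp_not_empty odd_Int assms(2) by blast+
  then show "2 * card ?\<A> = card (Pow U)" using assms(1) by (intro card_Pow_even_Int) auto
  fix A B assume AB: "A \<in> ?\<A>" "B \<in> ?\<A>" and "sym_diff A B \<in> \<D>"
  have "finite (A \<inter> W)" "finite (B \<inter> W)" using AB assms(1) finite_subset by blast+
  then have "even (card (sym_diff (A \<inter> W) (B \<inter> W)))" using AB by (simp add: even_card_sym_diff)
  also have "sym_diff (A \<inter> W) (B \<inter> W) = W \<inter> sym_diff A B" by blast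
  finally show False using odd_Int[OF \<open>sym_diff A B \<in> \<D>\<close>] by blast
qed

definition cube_parity :: "nat \<Rightarrow> (nat set \<Rightarrow> bool) \<Rightarrow> bool" where
  "cube_parity d P \<longleftrightarrow> (\<exists>W. finite W \<and> (\<forall>S. P S \<longleftrightarrow> odd (card (W \<inter> cart_power S d))))"

lemma cube_parity_False: "cube_parity d (\<lambda>S. False)"
  unfolding cube_parity_def by (rule exI[of _ "{}"]) simp

lemma cube_parity_neq:
  assumes "cube_parity d P" "cube_parity d Q"
  shows "cube_parity d (\<lambda>S. P S \<noteq> Q S)"
proof -
  obtain V W where V: "finite V" "\<And>S. P S \<longleftrightarrow> odd (card (V \<inter> cart_power S d))"
    and W: "finite W" "\<And>S. Q S \<longleftrightarrow> odd (card (W \<inter> cart_power S d))"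
    using assms unfolding cube_parity_def by metis
  have "sym_diff V W \<inter> C = sym_diff (V \<inter> C) (W \<inter> C)" for C by blast
  then have "(P S \<noteq> Q S) \<longleftrightarrow> odd (card (sym_diff V W \<inter> cart_power S d))" for S
    using V W by (simp add: even_card_sym_diff)
  moreover have "finite (sym_diff V W)" using V(1) W(1) by simp
  ultimately show ?thesis unfolding cube_parity_def by blast
qed

lemma cube_parity_odd_card:
  assumes "finite X" "\<And>x. x \<in> X \<Longrightarrow> cube_parity d (P x)"
  shows "cube_parity d (\<lambda>S. odd (card {x \<in> X. P x S}))"
  using assms
proof (induction X)
  case empty
  show ?case by (simp add: cube_parity_False)
next
  case (insert x X)
  have "{y \<in> insert x X. P y S} = (if P x S then insert x {y \<in> X. P y S} else {y \<in> X. P y S})" for S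
    by auto
  then have parity_insert:
    "odd (card {y \<in> insert x X. P y S}) \<longleftrightarrow> P x S \<noteq> odd (card {y \<in> X. P y S})" for S
    using insert.hyps by simp
  show ?case unfolding parity_insert using insert by (intro cube_parity_neq) auto
qed

lemma mem_cart_power_iff: "w \<in> cart_power S d \<longleftrightarrow> w \<in> extensional {1..d} \<and> w ` {1..d} \<subseteq> S"
  by (auto simp: cart_power_def PiE_def)

lemma cart_power_mono: "S \<subseteq> T \<Longrightarrow> cart_power S d \<subseteq> cart_power T d"
  unfolding cart_power_def by (rule PiE_mono)

lemma cube_parity_superset:
  assumes "finite T" "T \<noteq> {}" "card T \<le> d"
  shows "cube_parity d (\<lambda>S. T \<subseteq> S)"
proof -
  obtain g where "g ` {1..d} = T"
    using card_le_inj[of T "{1..d}"] assms inj_on_iff_surj[of T "{1..d}"] by auto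
  then have "restrict g {1..d} \<in> cart_power S d \<longleftrightarrow> T \<subseteq> S" for S
    by (simp add: mem_cart_power_iff)
  then have "T \<subseteq> S \<longleftrightarrow> odd (card ({restrict g {1..d}} \<inter> cart_power S d))" for S
    by (simp add: Int_insert_left)
  then show ?thesis unfolding cube_parity_def by blast
qed

text \<open>Expand the product of the \<open>x\<^sub>i\<close>, \<open>i \<in> A\<close>, and the \<open>1 + x\<^sub>j\<close>, \<open>j \<in> B\<close>; in the monomial
  indexed by \<open>L \<subseteq> B\<close>, the term \<open>x\<^sub>j\<close> is picked for \<open>j \<in> L\<close>.\<close>

lemma cube_parity_superset_disjnt:
  assumes "finite A" "A \<noteq> {}" "finite B" "card A + card B \<le> d"
  shows "cube_parity d (\<lambda>S. A \<subseteq> S \<and> disjnt B S)"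
proof -
  have "cube_parity d (\<lambda>S. A \<union> L \<subseteq> S)" if "L \<in> Pow B" for L
  proof (rule cube_parity_superset)
    have "L \<subseteq> B" using that by blast
    then show "finite (A \<union> L)" using assms finite_subset by blast
    have "card (A \<union> L) \<le> card A + card L" by (rule card_Un_le)
    also have "card L \<le> card B" using \<open>finite B\<close> \<open>L \<subseteq> B\<close> by (rule card_mono)
    finally show "card (A \<union> L) \<le> d" using assms(4) by simp
  qed (use assms(2) in blast)
  then have "cube_parity d (\<lambda>S. odd (card {L \<in> Pow B. A \<union> L \<subseteq> S}))"
    using \<open>finite B\<close> by (intro cube_parity_odd_card) auto
  moreover have "odd (card {L \<in> Pow B. A \<union> L \<subseteq> S}) \<longleftrightarrow> A \<subseteq> S \<and> disjnt B S" for S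
  proof (cases "A \<subseteq> S")
    case True
    then have picked: "{L \<in> Pow B. A \<union> L \<subseteq> S} = Pow (B \<inter> S)" by blast
    have "finite (B \<inter> S)" using \<open>finite B\<close> by simp
    then show ?thesis unfolding picked disjnt_def using True odd_card_Pow_iff by blast
  qed simp
  ultimately show ?thesis by simp
qed

definition left_endpoints :: "nat set \<Rightarrow> nat set" where
  "left_endpoints S = S - Suc ` S"

lemma left_endpoints_nonempty:
  assumes "S \<noteq> {}"
  shows "left_endpoints S \<noteq> {}"
proof -
  have "(LEAST i. i \<in> S) \<in> S" using assms by (auto intro: LeastI)
  moreover have "(LEAST i. i \<in> S) \<notin> Suc ` S"
    using Least_le[of "\<lambda>i. i \<in> S"] by fastforce
  ultimately show ?thesis unfolding left_endpoints_def by blast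
qed

lemma left_endpoints_Union_subset: "left_endpoints (\<Union>\<I>) \<subseteq> (\<Union>I\<in>\<I>. left_endpoints I)"
  unfolding left_endpoints_def by blast

lemma left_endpoints_atLeastAtMost:
  assumes "a \<le> b"
  shows "left_endpoints {a..b} = {a}"
  unfolding left_endpoints_def using assms by auto

lemma card_left_endpoints_le:
  assumes "union_of_at_most_intervals k S"
  shows "card (left_endpoints S) \<le> k"
proof -
  obtain \<I> where \<I>: "finite \<I>" "card \<I> \<le> k" "\<And>I. I \<in> \<I> \<Longrightarrow> int_interval I" "S = \<Union>\<I>"
    using assms unfolding union_of_at_most_intervals_def by blast
  have single: "card (left_endpoints I) = 1" if "I \<in> \<I>" for I
    using \<I>(3)[OF that] left_endpoints_atLeastAtMost unfolding int_interval_def by auto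
  then have "finite (left_endpoints I)" if "I \<in> \<I>" for I
    using that by (simp add: card_ge_0_finite)
  then have "card (left_endpoints S) \<le> card (\<Union>I\<in>\<I>. left_endpoints I)"
    unfolding \<I>(4) using \<I>(1) by (intro card_mono left_endpoints_Union_subset) auto
  also have "\<dots> \<le> (\<Sum>I\<in>\<I>. card (left_endpoints I))"
    using \<I>(1) by (rule card_UN_le)
  also have "\<dots> = card \<I>" using single by simp
  finally show ?thesis using \<I>(2) by simp
qed

lemma union_of_at_most_intervals_singleton:
  assumes "1 \<le> k"
  shows "union_of_at_most_intervals k {a}"
proof -
  have "int_interval {a}" unfolding int_interval_def by (intro exI[of _ a]) simp
  then show ?thesis
    unfolding union_of_at_most_intervals_def using assms by (intro exI[of _ "{{a}}"]) simp
qed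

lemma cube_parity_subset_left_endpoints:
  assumes "finite J" "J \<noteq> {}" "2 * card J \<le> d"
  shows "cube_parity d (\<lambda>S. J \<subseteq> left_endpoints S)"
proof -
  have "J \<subseteq> left_endpoints S \<longleftrightarrow> J \<subseteq> S \<and> disjnt (Suc -` J) S" for S
    unfolding left_endpoints_def disjnt_def by blast
  moreover have "card (Suc -` J) \<le> card J"
    using card_vimage_inj_on_le[of Suc UNIV J] assms(1) by simp
  ultimately show ?thesis
    using assms by (simp add: cube_parity_superset_disjnt finite_vimageI)
qed

lemma exists_cube_parity_few_left_endpoints:
  assumes "finite N" "2 * k \<le> d"
  shows "\<exists>P. cube_parity d P \<and> (\<forall>S\<subseteq>N. S \<noteq> {} \<longrightarrow> card (left_endpoints S) \<le> k \<longrightarrow> P S)"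
proof (intro exI conjI allI impI)
  let ?\<J> = "{J. J \<subseteq> N \<and> J \<noteq> {} \<and> card J \<le> k}"
  show "cube_parity d (\<lambda>S. odd (card {J \<in> ?\<J>. J \<subseteq> left_endpoints S}))"
  proof (rule cube_parity_odd_card)
    show "finite ?\<J>" using assms by simp
    show "cube_parity d (\<lambda>S. J \<subseteq> left_endpoints S)" if "J \<in> ?\<J>" for J
      using that assms finite_subset by (intro cube_parity_subset_left_endpoints) auto
  qed
  fix S assume "S \<subseteq> N" "S \<noteq> {}" and few: "card (left_endpoints S) \<le> k"
  let ?L = "left_endpoints S"
  have "?L \<subseteq> N" using \<open>S \<subseteq> N\<close> unfolding left_endpoints_def by blast
  then have "finite ?L" using assms finite_subset by blast
  have "card J \<le> k" if "J \<subseteq> ?L" for J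
    using card_mono[OF \<open>finite ?L\<close> that] few by simp
  then have "{J \<in> ?\<J>. J \<subseteq> ?L} = Pow ?L - {{}}"
    using \<open>?L \<subseteq> N\<close> by blast
  then show "odd (card {J \<in> ?\<J>. J \<subseteq> ?L})"
    using odd_card_nonempty_subsets[OF \<open>finite ?L\<close> left_endpoints_nonempty[OF \<open>S \<noteq> {}\<close>]] by simp
qed

theorem theorem1p3:
  fixes n d :: nat
  assumes "d \<ge> 2" and "n \<ge> d"
  shows "\<exists>\<A>. \<A> \<subseteq> Pow (cart_power {1..n} d) \<and>
           real (card \<A>) = real (card (Pow (cart_power {1..n} d))) / 2 \<and>
           \<not> (\<exists>(A, B) \<in> \<A> \<times> \<A>. \<exists>S. S \<noteq> {} \<and> S \<subseteq> {1..n} \<and>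
                 union_of_at_most_intervals (d div 2) S \<and>
                 sym_diff A B = cart_power S d)"
proof -
  let ?U = "cart_power {1..n} d"
  let ?admissible = "\<lambda>S. S \<noteq> {} \<and> S \<subseteq> {1..n} \<and> union_of_at_most_intervals (d div 2) S"
  let ?\<D> = "(\<lambda>S. cart_power S d) ` Collect ?admissible"
  obtain P where "cube_parity d P" and P: "\<And>S. ?admissible S \<Longrightarrow> P S"
    using exists_cube_parity_few_left_endpoints[of "{1..n}" "d div 2" d] card_left_endpoints_le
    by auto
  then obtain W where W: "\<And>S. ?admissible S \<Longrightarrow> odd (card (W \<inter> cart_power S d))"
    unfolding cube_parity_def by blast
  have "?admissible {1}"
    using assms union_of_at_most_intervals_singleton by simp
  then have "?\<D> \<noteq> {}" by blast
  moreover have "?\<D> \<subseteq> Pow ?U" using cart_power_mono by blast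
  moreover have "finite ?U" by (simp add: cart_power_def finite_PiE)
  moreover have "odd (card (W \<inter> D))" if "D \<in> ?\<D>" for D using that W by blast
  ultimately obtain \<A> where \<A>: "\<A> \<subseteq> Pow ?U" "2 * card \<A> = card (Pow ?U)"
    "\<forall>A\<in>\<A>. \<forall>B\<in>\<A>. sym_diff A B \<notin> ?\<D>"
    using exists_half_family_avoiding_sym_diffs[of ?U ?\<D> W] by meson
  have "real (card \<A>) = real (card (Pow ?U)) / 2"
    unfolding \<A>(2)[symmetric] by simp
  moreover have "sym_diff A B \<noteq> cart_power S d" if "A \<in> \<A>" "B \<in> \<A>" "?admissible S" for A B S
    using \<A>(3) that by blast
  ultimately show ?thesis using \<A>(1) by (intro exI[of _ \<A>]) auto
qed

end
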